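(* Let $n \ge 1$ be an integer, let $A \subset E_2^n$ be a subset with $|A| \ge 1$, and let $B \in J_A$, i.e. $B \subset E_2^n$ is isometric to $A$. Then: 1) $R(B) = 0$ if $|A| = 1$; 2) $\dfrac{4D_A}{|A|^2} \le R(B) \le \dfrac{D_A}{|A|-1}$ if $|A| > 1$ and $|A|$ is even; 3) $\dfrac{4D_A}{|A|^2-1} \le R(B) \le \dfrac{D_A}{|A|-1}$ if $|A| > 1$ and $|A|$ is odd.
   Context: $E_2^n = \{0,1\}^n$ is the $n$-dimensional binary cube, with Hamming distance $d_H(x,y)$ = number of coordinates in which $x$ and $y$ differ. A $k$-dimensional face of $E_2^n$ is the set of all vectors in $E_2^n$ having prescribed fixed values in some fixed $n-k$ coordinates. The rank $R(A)$ of a non-empty subset $A \subset E_2^n$ is the dimension of the smallest face containing $A$; equivalently, it is the number of coordinates that are not constant on $A$. Subsets $A, B \subset E_2^n$ are isometric if there is a bijection $\varphi : A \to B$ with $d_H(a,a') = d_H(\varphi(a),\varphi(a'))$ for all $a,a' \in A$; $J_A$ denotes the class of all subsets of $E_2^n$ isometric to $A$. $D_A = \sum_{\{x,y\} \subset A,\, x \ne y} d_H(x,y)$ is the sum of Hamming distances over all unordered pairs of distinct vectors of $A$. The inequalities are between real (rational) numbers. *)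

theory Defs
  imports Complex_Main "HOL-Library.FuncSet"
begin

definition cube :: "nat \<Rightarrow> (nat \<Rightarrow> nat) set" where
  "cube n = {1..n} \<rightarrow>\<^sub>E {0, 1}"

definition hamming :: "nat \<Rightarrow> (nat \<Rightarrow> nat) \<Rightarrow> (nat \<Rightarrow> nat) \<Rightarrow> nat" where
  "hamming n x y = card {i \<in> {1..n}. x i \<noteq> y i}"

text \<open>Here \<open>I\<close> is the set of the \<open>n - k\<close> fixed coordinates and \<open>z\<close> carries the prescribed values.\<close>

definition is_face :: "nat \<Rightarrow> nat \<Rightarrow> (nat \<Rightarrow> nat) set \<Rightarrow> bool" where
  "is_face n k F \<longleftrightarrow> k \<le> n \<and>
     (\<exists>I z. I \<subseteq> {1..n} \<and> card I = n - k \<and> z \<in> cube n \<and>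
        F = {x \<in> cube n. \<forall>i\<in>I. x i = z i})"

text \<open>For a non-empty subset of the cube, the face of least dimension containing it is also the
  least one with respect to inclusion; see \<open>rank_smallest_face\<close> and \<open>rank_eq_card\<close> below.\<close>

definition rank :: "nat \<Rightarrow> (nat \<Rightarrow> nat) set \<Rightarrow> nat" where
  "rank n A = (LEAST k. \<exists>F. is_face n k F \<and> A \<subseteq> F)"

definition isometric :: "nat \<Rightarrow> (nat \<Rightarrow> nat) set \<Rightarrow> (nat \<Rightarrow> nat) set \<Rightarrow> bool" where
  "isometric n A B \<longleftrightarrow>
     (\<exists>\<phi>. bij_betw \<phi> A B \<and> (\<forall>a\<in>A. \<forall>a'\<in>A. hamming n a a' = hamming n (\<phi> a) (\<phi> a')))"

definition isometry_class :: "nat \<Rightarrow> (nat \<Rightarrow> nat) set \<Rightarrow> (nat \<Rightarrow> nat) set set" where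
  "isometry_class n A = {B. B \<subseteq> cube n \<and> isometric n A B}"

text \<open>The distance of an unordered pair is well defined because \<open>hamming\<close> is symmetric.\<close>

definition pair_dist :: "nat \<Rightarrow> (nat \<Rightarrow> nat) set \<Rightarrow> nat" where
  "pair_dist n P = (THE d. \<exists>x y. P = {x, y} \<and> d = hamming n x y)"

definition dist_sum :: "nat \<Rightarrow> (nat \<Rightarrow> nat) set \<Rightarrow> nat" where
  "dist_sum n A = (\<Sum>P\<in>{{x, y} |x y. x \<in> A \<and> y \<in> A \<and> x \<noteq> y}. pair_dist n P)"

lemma hamming_commute: "hamming n x y = hamming n y x"
  unfolding hamming_def by (rule arg_cong[where f = card]) auto

lemma pair_dist_eq: "pair_dist n {x, y} = hamming n x y"
  unfolding pair_dist_def by (rule the_equality) (auto simp: doubleton_eq_iff hamming_commute)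

lemma two_dist_sum:
  assumes "finite A"
  shows "2 * dist_sum n A = (\<Sum>x\<in>A. \<Sum>y\<in>A. hamming n x y)"
  using assms
proof (induction A rule: finite_induct)
  case empty
  then show ?case by (simp add: dist_sum_def)
next
  case (insert a A)
  let ?P = "\<lambda>S. {{x, y} |x y. x \<in> S \<and> y \<in> S \<and> x \<noteq> y}"
  have split: "?P (insert a A) = ?P A \<union> (\<lambda>y. {a, y}) ` A"
    using insert.hyps by (auto simp: image_iff)
  have fin: "finite (?P A)"
    by (rule finite_subset[of _ "Pow A"]) (use insert.hyps in auto)
  have disj: "?P A \<inter> (\<lambda>y. {a, y}) ` A = {}"
    using insert.hyps by (auto simp: doubleton_eq_iff)
  have inj: "inj_on (\<lambda>y. {a, y}) A"
    by (auto simp: inj_on_def doubleton_eq_iff)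
  have "dist_sum n (insert a A) = dist_sum n A + (\<Sum>y\<in>A. hamming n a y)"
    unfolding dist_sum_def split
    using fin disj insert.hyps
    by (subst sum.union_disjoint) (auto simp: sum.reindex[OF inj] pair_dist_eq)
  moreover have "hamming n a a = 0" by (simp add: hamming_def)
  moreover have "(\<Sum>x\<in>A. hamming n x a) = (\<Sum>y\<in>A. hamming n a y)"
    by (simp add: hamming_commute)
  ultimately show ?case
    using insert by (simp add: sum.distrib)
qed

lemma is_faceE:
  assumes "is_face n k F"
  obtains I z where "I \<subseteq> {1..n}" "card I = n - k" "k \<le> n"
    "F = {x \<in> cube n. \<forall>i\<in>I. x i = z i}"
  using assms unfolding is_face_def by (elim conjE exE) (rule that)

lemma rank_aux:
  assumes "A \<subseteq> cube n" "A \<noteq> {}"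
  defines "V \<equiv> {i \<in> {1..n}. \<exists>x\<in>A. \<exists>y\<in>A. x i \<noteq> y i}"
  shows "\<exists>F. is_face n (card V) F \<and> A \<subseteq> F \<and> (\<forall>k G. is_face n k G \<and> A \<subseteq> G \<longrightarrow> F \<subseteq> G)"
    and "is_face n k G \<Longrightarrow> A \<subseteq> G \<Longrightarrow> card V \<le> k"
proof -
  obtain z where z: "z \<in> A" using assms by blast
  have V: "V \<subseteq> {1..n}" by (auto simp: V_def)
  have cV: "card V \<le> n" using card_mono[OF _ V] by simp
  let ?F = "{x \<in> cube n. \<forall>i\<in>{1..n} - V. x i = z i}"
  have I: "I \<subseteq> {1..n} - V" if "I \<subseteq> {1..n}" "A \<subseteq> {x \<in> cube n. \<forall>i\<in>I. x i = w i}" for I w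
  proof
    fix i assume i: "i \<in> I"
    then have "\<forall>x\<in>A. x i = w i" using \<open>A \<subseteq> {x \<in> cube n. \<forall>i\<in>I. x i = w i}\<close> by blast
    then have "\<not> (\<exists>x\<in>A. \<exists>y\<in>A. x i \<noteq> y i)" by metis
    then have "i \<notin> V" by (simp add: V_def)
    then show "i \<in> {1..n} - V" using i \<open>I \<subseteq> {1..n}\<close> by blast
  qed
  have face: "is_face n (card V) ?F"
    unfolding is_face_def
    using z assms(1) V cV
    by (intro conjI exI[of _ "{1..n} - V"] exI[of _ z])
       (auto simp: card_Diff_subset finite_subset[OF V])
  have sub: "A \<subseteq> ?F" using z assms(1) by (auto simp: V_def)
  have least: "?F \<subseteq> G" if G: "is_face n k G" "A \<subseteq> G" for k G
  proof -
    obtain I w where w: "I \<subseteq> {1..n}" "G = {x \<in> cube n. \<forall>i\<in>I. x i = w i}"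
      using G(1) by (rule is_faceE)
    have "I \<subseteq> {1..n} - V" using G(2) unfolding w(2) by (rule I[OF w(1)])
    moreover have "z \<in> G" using z G by blast
    ultimately show ?thesis unfolding w(2) by (auto simp: subset_iff)
  qed
  show "\<exists>F. is_face n (card V) F \<and> A \<subseteq> F \<and> (\<forall>k G. is_face n k G \<and> A \<subseteq> G \<longrightarrow> F \<subseteq> G)"
    using face sub least by blast
  show "card V \<le> k" if G: "is_face n k G" "A \<subseteq> G"
  proof -
    obtain I w where w: "I \<subseteq> {1..n}" "card I = n - k" "k \<le> n"
      "G = {x \<in> cube n. \<forall>i\<in>I. x i = w i}"
      using G(1) by (rule is_faceE)
    have "I \<subseteq> {1..n} - V" using G(2) unfolding w(4) by (rule I[OF w(1)])
    then have "card I \<le> card ({1..n} - V)" by (intro card_mono) auto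
    also have "\<dots> = n - card V" using V by (simp add: card_Diff_subset finite_subset[OF V])
    finally show ?thesis using w cV by linarith
  qed
qed

lemma rank_eq_card:
  assumes "A \<subseteq> cube n" "A \<noteq> {}"
  shows "rank n A = card {i \<in> {1..n}. \<exists>x\<in>A. \<exists>y\<in>A. x i \<noteq> y i}"
  unfolding rank_def
  using rank_aux[OF assms] by (intro Least_equality) blast+

lemma rank_smallest_face:
  assumes "A \<subseteq> cube n" "A \<noteq> {}"
  shows "\<exists>F. is_face n (rank n A) F \<and> A \<subseteq> F \<and> (\<forall>k G. is_face n k G \<and> A \<subseteq> G \<longrightarrow> F \<subseteq> G)"
  unfolding rank_eq_card[OF assms] by (rule rank_aux(1)[OF assms])

end

theory Submission
  imports Defs
begin

text \<open>Counting coordinate by coordinate, \<open>dist_sum n B\<close> is the sum of \<open>k\<^sub>i (m - k\<^sub>i)\<close> over the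
  coordinates \<open>i\<close> that are not constant on \<open>B\<close>, where \<open>m = card B\<close> and \<open>k\<^sub>i\<close> counts the vectors of \<open>B\<close>
  with a one in position \<open>i\<close>. There are \<open>rank n B\<close> such coordinates, and each summand lies between
  \<open>m - 1\<close> and \<open>m\<^sup>2 / 4\<close>, or \<open>(m\<^sup>2 - 1) / 4\<close> if \<open>m\<close> is odd.\<close>

text \<open>The factor 2 appears because every pair separated by \<open>P\<close> is met in both
  orders. Fixing \<open>x\<close>, the inner sum counts the vectors on the opposite side of
  \<open>P\<close>.\<close>

lemma sum_disagreements:
  assumes "finite A"
  shows "(\<Sum>x\<in>A. \<Sum>y\<in>A. of_bool (P x \<noteq> P y)) = 2 * (card {x \<in> A. P x} * card {x \<in> A. \<not> P x})"
proof -
  have inner: "(\<Sum>y\<in>A. of_bool (P x \<noteq> P y)) =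
      (if P x then card {y \<in> A. \<not> P y} else card {y \<in> A. P y})" for x
    using assms by (auto simp: of_bool_def sum.If_cases Int_def)
  show ?thesis
    unfolding inner using assms by (simp add: sum.If_cases Int_def Compl_eq)
qed

lemma dist_sum_eq_sum_coordinates:
  assumes "finite A" "A \<subseteq> cube n"
  shows "dist_sum n A = (\<Sum>i\<in>{1..n}. card {x \<in> A. x i = 1} * card {x \<in> A. x i \<noteq> 1})"
proof -
  \<comment> \<open>Entries are 0 or 1, so a disagreement of values is a disagreement on the
    predicate \<open>x i = 1\<close>; this is the form that \<open>sum_disagreements\<close>
    counts.\<close>
  have binary: "x i \<noteq> y i \<longleftrightarrow> (x i = 1) \<noteq> (y i = 1)"
    if "x \<in> A" "y \<in> A" "i \<in> {1..n}" for x y i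
  proof -
    have "x i \<in> {0, 1}" "y i \<in> {0, 1}"
      using that assms(2) unfolding cube_def by (blast dest: PiE_mem)+
    then show ?thesis by auto
  qed
  have "hamming n x y = (\<Sum>i\<in>{1..n}. of_bool ((x i = 1) \<noteq> (y i = 1)))"
    if "x \<in> A" "y \<in> A" for x y
  proof -
    have "hamming n x y = (\<Sum>i\<in>{1..n}. of_bool (x i \<noteq> y i))"
      by (simp add: hamming_def of_bool_def sum.If_cases Int_def)
    also have "\<dots> = (\<Sum>i\<in>{1..n}. of_bool ((x i = 1) \<noteq> (y i = 1)))"
      by (rule sum.cong) (use binary[OF that] in auto)
    finally show ?thesis .
  qed
  then have "2 * dist_sum n A =
      (\<Sum>x\<in>A. \<Sum>y\<in>A. \<Sum>i\<in>{1..n}. of_bool ((x i = 1) \<noteq> (y i = 1)))"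
    using two_dist_sum[OF assms(1)] by simp
  \<comment> \<open>Two exchanges of summation bring the coordinate outermost.\<close>
  also have "\<dots> = (\<Sum>x\<in>A. \<Sum>i\<in>{1..n}. \<Sum>y\<in>A. of_bool ((x i = 1) \<noteq> (y i = 1)))"
    by (intro sum.cong refl sum.swap)
  also have "\<dots> = (\<Sum>i\<in>{1..n}. \<Sum>x\<in>A. \<Sum>y\<in>A. of_bool ((x i = 1) \<noteq> (y i = 1)))"
    by (rule sum.swap)
  also have "\<dots> = 2 * (\<Sum>i\<in>{1..n}. card {x \<in> A. x i = 1} * card {x \<in> A. x i \<noteq> 1})"
    by (simp only: sum_disagreements[OF assms(1)] sum_distrib_left)
  finally show ?thesis by simp
qed

text \<open>Doubling turns the sum over unordered pairs into a sum over ordered ones, which can be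
  reindexed along the bijection. This allows bounds for \<open>B\<close> to be stated through
  \<open>A\<close>.\<close>

lemma dist_sum_isometric:
  assumes "isometric n A B" "finite A"
  shows "dist_sum n B = dist_sum n A"
proof -
  obtain f where f: "bij_betw f A B"
    "\<And>a a'. a \<in> A \<Longrightarrow> a' \<in> A \<Longrightarrow> hamming n a a' = hamming n (f a) (f a')"
    using assms(1) unfolding isometric_def by blast
  have "finite B" using f(1) assms(2) bij_betw_finite by blast
  then have "2 * dist_sum n B = (\<Sum>x\<in>B. \<Sum>y\<in>B. hamming n x y)"
    by (rule two_dist_sum)
  also have "\<dots> = (\<Sum>x\<in>A. \<Sum>y\<in>A. hamming n (f x) (f y))"
    by (simp add: sum.reindex_bij_betw[OF f(1), symmetric])
  also have "\<dots> = 2 * dist_sum n A"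
    using f(2) by (simp add: two_dist_sum[OF assms(2)])
  finally show ?thesis by simp
qed

text \<open>The gap is the square of \<open>k - l\<close>; if \<open>k + l\<close> is odd, then
  \<open>k\<close> and \<open>l\<close> differ, so this square is at least 1.\<close>

lemma four_mult_le_square_add:
  fixes k l :: nat
  shows "4 * real (k * l) \<le> (real (k + l))\<^sup>2"
    and "odd (k + l) \<Longrightarrow> 4 * real (k * l) \<le> (real (k + l))\<^sup>2 - 1"
proof -
  have eq: "(real (k + l))\<^sup>2 - 4 * real (k * l) = (real k - real l)\<^sup>2"
    by (simp add: power2_eq_square algebra_simps)
  show "4 * real (k * l) \<le> (real (k + l))\<^sup>2"
    using eq zero_le_power2[of "real k - real l"] by linarith
  assume "odd (k + l)"
  then have "k \<noteq> l" by auto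
  then have "1 \<le> \<bar>real k - real l\<bar>" by linarith
  then have "1 \<le> (real k - real l)\<^sup>2" by (simp add: abs_le_square_iff[of 1, simplified])
  then show "4 * real (k * l) \<le> (real (k + l))\<^sup>2 - 1"
    using eq by linarith
qed

text \<open>The difference of the two sides is \<open>(k - 1) * (l - 1)\<close>.\<close>

lemma add_minus_one_le_mult:
  fixes k l :: nat
  assumes "k > 0" "l > 0"
  shows "real (k + l) - 1 \<le> real (k * l)"
proof -
  have "0 \<le> (real k - 1) * (real l - 1)"
    using assms by (intro mult_nonneg_nonneg) auto
  then show ?thesis by (simp add: algebra_simps)
qed

lemma rank_dist_sum_bounds:
  assumes "finite B" "B \<noteq> {}" "B \<subseteq> cube n"
  shows "(real (card B) - 1) * real (rank n B) \<le> real (dist_sum n B)"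
    and "4 * real (dist_sum n B) \<le> (real (card B))\<^sup>2 * real (rank n B)"
    and "odd (card B) \<Longrightarrow> 4 * real (dist_sum n B) \<le> ((real (card B))\<^sup>2 - 1) * real (rank n B)"
proof -
  define V where "V = {i \<in> {1..n}. \<exists>x\<in>B. \<exists>y\<in>B. x i \<noteq> y i}"
  define k l where "k i = card {x \<in> B. x i = 1}" and "l i = card {x \<in> B. x i \<noteq> 1}" for i
  have rank: "rank n B = card V"
    unfolding V_def by (rule rank_eq_card[OF assms(3,2)])
  have kl: "k i + l i = card B" for i
  proof -
    have "card B = card ({x \<in> B. x i = 1} \<union> {x \<in> B. x i \<noteq> 1})"
      by (rule arg_cong[where f = card]) auto
    also have "\<dots> = k i + l i"
      unfolding k_def l_def using assms(1) by (intro card_Un_disjoint) auto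
    finally show ?thesis by simp
  qed
  \<comment> \<open>On a constant coordinate one of the two classes is empty, so the sum may be
    restricted to \<open>V\<close>.\<close>
  have zero: "k i * l i = 0" if "i \<in> {1..n} - V" for i
  proof -
    obtain b where "b \<in> B" using assms(2) by blast
    then have "x i = b i" if "x \<in> B" for x
      using that \<open>i \<in> {1..n} - V\<close> unfolding V_def by blast
    then have "x i = 1 \<longleftrightarrow> b i = 1" if "x \<in> B" for x
      using that by metis
    then have "{x \<in> B. x i = 1} = {} \<or> {x \<in> B. x i \<noteq> 1} = {}"
      by blast
    then show ?thesis unfolding k_def l_def by (elim disjE) (simp_all only: card.empty mult_0 mult_0_right)
  qed
  \<comment> \<open>Both values 0 and 1 occur on a coordinate in \<open>V\<close>; the lower bound
    on each summand depends on this.\<close>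
  have pos: "k i > 0 \<and> l i > 0" if i: "i \<in> V" for i
  proof -
    obtain x y where xy: "x \<in> B" "y \<in> B" "x i \<noteq> y i" using i by (auto simp: V_def)
    moreover have "x i \<in> {0, 1}" "y i \<in> {0, 1}"
      using xy i assms(3) unfolding cube_def V_def by (blast dest: PiE_mem)+
    ultimately show ?thesis
      using assms(1) by (auto simp: k_def l_def card_gt_0_iff)
  qed
  have "dist_sum n B = (\<Sum>i\<in>{1..n}. k i * l i)"
    unfolding k_def l_def by (rule dist_sum_eq_sum_coordinates[OF assms(1,3)])
  also have "\<dots> = (\<Sum>i\<in>V. k i * l i)"
    using zero by (intro sum.mono_neutral_right) (auto simp: V_def)
  finally have D: "real (dist_sum n B) = (\<Sum>i\<in>V. real (k i * l i))" by simp
  have "real (card V) * (real (card B) - 1) \<le> (\<Sum>i\<in>V. real (k i * l i))"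
    using pos add_minus_one_le_mult[of "k i" "l i" for i] by (intro sum_bounded_below) (simp add: kl)
  then show "(real (card B) - 1) * real (rank n B) \<le> real (dist_sum n B)"
    by (simp add: D rank mult.commute)
  have "(\<Sum>i\<in>V. 4 * real (k i * l i)) \<le> real (card V) * (real (card B))\<^sup>2"
    using four_mult_le_square_add(1)[of "k i" "l i" for i] by (intro sum_bounded_above) (simp add: kl)
  then show "4 * real (dist_sum n B) \<le> (real (card B))\<^sup>2 * real (rank n B)"
    by (simp add: D rank mult.commute sum_distrib_left)
  assume "odd (card B)"
  then have "(\<Sum>i\<in>V. 4 * real (k i * l i)) \<le> real (card V) * ((real (card B))\<^sup>2 - 1)"
    using four_mult_le_square_add(2)[of "k i" "l i" for i] by (intro sum_bounded_above) (simp add: kl)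
  then show "4 * real (dist_sum n B) \<le> ((real (card B))\<^sup>2 - 1) * real (rank n B)"
    by (simp add: D rank mult.commute sum_distrib_left)
qed

theorem theorem1:
  fixes n :: nat and A B :: "(nat \<Rightarrow> nat) set"
  assumes "n \<ge> 1"
    and "A \<subseteq> cube n"
    and "card A \<ge> 1"
    and "B \<in> isometry_class n A"
  shows "(card A = 1 \<longrightarrow> rank n B = 0) \<and>
    (card A > 1 \<and> even (card A) \<longrightarrow>
       4 * real (dist_sum n A) / (real (card A))\<^sup>2 \<le> real (rank n B) \<and>
       real (rank n B) \<le> real (dist_sum n A) / (real (card A) - 1)) \<and>
    (card A > 1 \<and> odd (card A) \<longrightarrow>
       4 * real (dist_sum n A) / ((real (card A))\<^sup>2 - 1) \<le> real (rank n B) \<and>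
       real (rank n B) \<le> real (dist_sum n A) / (real (card A) - 1))"
proof -
  have A: "finite A" using assms(3) card.infinite by fastforce
  have B: "B \<subseteq> cube n" and iso: "isometric n A B"
    using assms(4) by (auto simp: isometry_class_def)
  then have card: "card B = card A"
    unfolding isometric_def using bij_betw_same_card by metis
  then have fin: "finite B" "B \<noteq> {}"
    using assms(3) card.infinite by fastforce+
  note bounds = rank_dist_sum_bounds[OF fin B, unfolded card dist_sum_isometric[OF iso A]]
  \<comment> \<open>For one vector the factor \<open>card A - 1\<close> vanishes and
    \<open>bounds\<close> gives no upper bound on the rank, so the varying coordinates are counted
    directly.\<close>
  have single: "rank n B = 0" if "card A = 1"
  proof -
    obtain b where "B = {b}" using card \<open>card A = 1\<close> card_1_singletonE[of B] by auto
    then show ?thesis using rank_eq_card[OF B fin(2)] by simp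
  qed
  \<comment> \<open>Positive denominators turn the product inequalities in \<open>bounds\<close>
    into the quotients.\<close>
  have pos: "0 < real (card A) - 1" "0 < (real (card A))\<^sup>2 - 1" if "card A > 1"
    using that by (simp_all add:)
  show ?thesis
    using single bounds pos
    by (auto simp: pos_divide_le_eq pos_le_divide_eq mult.commute)
qed

end
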